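(* Let $A$ be a Banach function algebra, and let $E\subseteq M(A)$ be a non-empty $t$-analytic set for $A$. Then $I_A(E)=\{f\in A: f\equiv 0\text{ on }E\}$ is a closed prime ideal in $A$.
   Context: A Banach function algebra $A$ is a commutative, unital, semisimple complex Banach algebra, regarded via the Gelfand transform as an algebra of continuous functions on its character space $M(A)$ (the compact Hausdorff space of non-zero multiplicative linear functionals on $A$ with the Gelfand, i.e. weak-$*$, topology). A set $E\subseteq M(A)$ is a $t$-analytic set for $A$ if for every $f\in A$ and every non-empty relatively open subset $U$ of $E$, $f\equiv 0$ on $U$ implies $f\equiv 0$ on $E$. *)

theory Defs
  imports "HOL-Analysis.Analysis" "HOL-Algebra.Algebraic_Closure_Type"
begin

text \<open>
  The algebra is a type; its ring structure is passed to the ideal theory of HOL-Algebra through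
  \<^const>\<open>ring_of_type_algebra\<close>.  The norm is submultiplicative and complete; \<open>norm 1 = 1\<close> is
  not required, so both usual conventions for unital Banach algebras are covered.  The class
  \<^class>\<open>comm_ring_1\<close> includes \<open>0 \<noteq> 1\<close>, which only excludes the zero algebra, whose character
  space is empty.
\<close>

class scaleC =
  fixes scaleC :: "complex \<Rightarrow> 'a \<Rightarrow> 'a"  (infixr \<open>*\<^sub>C\<close> 75)

class comm_complex_banach_algebra = scaleC + comm_ring_1 + real_normed_algebra + banach +
  assumes scaleC_add_right: "c *\<^sub>C (x + y) = c *\<^sub>C x + c *\<^sub>C y"
    and scaleC_add_left: "(c + d) *\<^sub>C x = c *\<^sub>C x + d *\<^sub>C x"
    and scaleC_scaleC: "c *\<^sub>C (d *\<^sub>C x) = (c * d) *\<^sub>C x"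
    and scaleC_one: "1 *\<^sub>C x = x"
    and scaleC_of_real: "complex_of_real r *\<^sub>C x = r *\<^sub>R x"
    and mult_scaleC_left: "(c *\<^sub>C x) * y = c *\<^sub>C (x * y)"
    and norm_scaleC: "norm (c *\<^sub>C x) = cmod c * norm x"

definition (in comm_ring_1) jacobson_radical :: "'a set" where
  "jacobson_radical = \<Inter> {I. maximalideal I (ring_of_type_algebra :: 'a ring)}"

class banach_function_algebra = comm_complex_banach_algebra +
  assumes semisimple: "jacobson_radical = {0}"

definition character_space :: "('a::comm_complex_banach_algebra \<Rightarrow> complex) set" where
  "character_space = {\<phi>.
     (\<forall>f g. \<phi> (f + g) = \<phi> f + \<phi> g) \<and>
     (\<forall>c f. \<phi> (c *\<^sub>C f) = c * \<phi> f) \<and>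
     (\<forall>f g. \<phi> (f * g) = \<phi> f * \<phi> g) \<and>
     (\<exists>f. \<phi> f \<noteq> 0)}"

text \<open>The weak-* topology is the topology of pointwise convergence on the algebra.\<close>

definition gelfand_topology :: "('a::comm_complex_banach_algebra \<Rightarrow> complex) topology" where
  "gelfand_topology = subtopology (product_topology (\<lambda>_. euclidean) UNIV) character_space"

definition gelfand_transform ::
    "'a::comm_complex_banach_algebra \<Rightarrow> ('a \<Rightarrow> complex) \<Rightarrow> complex" where
  "gelfand_transform f \<phi> = \<phi> f"

definition t_analytic :: "('a::banach_function_algebra \<Rightarrow> complex) set \<Rightarrow> bool" where
  "t_analytic E \<longleftrightarrow> E \<subseteq> character_space \<and>
     (\<forall>f U. openin (subtopology gelfand_topology E) U \<and> U \<noteq> {} \<and>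
        (\<forall>\<phi>\<in>U. gelfand_transform f \<phi> = 0) \<longrightarrow> (\<forall>\<phi>\<in>E. gelfand_transform f \<phi> = 0))"

definition vanishing_ideal :: "('a::banach_function_algebra \<Rightarrow> complex) set \<Rightarrow> 'a set" where
  "vanishing_ideal E = {f. \<forall>\<phi>\<in>E. gelfand_transform f \<phi> = 0}"

end

theory Submission
  imports Defs
begin

text \<open>
  Closedness needs every character \<open>\<phi>\<close> to be continuous, in fact contractive: if \<open>\<phi> f = 1\<close> and
  \<open>\<parallel>f\<parallel> < 1\<close>, then \<open>g = f + f\<^sup>2 + f\<^sup>3 + \<dots>\<close> satisfies \<open>g = f + f g\<close>, so \<open>\<phi> g = 1 + \<phi> g\<close>.  For
  primality, if \<open>f g\<close> vanishes on \<open>E\<close> but \<open>f\<close> does not, then \<open>g\<close> vanishes on the non-empty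
  relatively open set where \<open>f \<noteq> 0\<close>, hence on \<open>E\<close>.
\<close>

lemma character_add: "\<phi> \<in> character_space \<Longrightarrow> \<phi> (f + g) = \<phi> f + \<phi> g"
  and character_scaleC: "\<phi> \<in> character_space \<Longrightarrow> \<phi> (c *\<^sub>C f) = c * \<phi> f"
  and character_mult: "\<phi> \<in> character_space \<Longrightarrow> \<phi> (f * g) = \<phi> f * \<phi> g"
  and character_nonzero: "\<phi> \<in> character_space \<Longrightarrow> \<exists>f. \<phi> f \<noteq> 0"
  by (simp_all add: character_space_def)

lemma character_zero: "\<phi> \<in> character_space \<Longrightarrow> \<phi> 0 = 0"
  using character_add[of \<phi> 0 0] by simp

lemma character_uminus: "\<phi> \<in> character_space \<Longrightarrow> \<phi> (- f) = - \<phi> f"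
  using character_add[of \<phi> f "- f"] character_zero[of \<phi>] by (simp add: eq_neg_iff_add_eq_0 add.commute)

lemma character_diff: "\<phi> \<in> character_space \<Longrightarrow> \<phi> (f - g) = \<phi> f - \<phi> g"
  using character_add[of \<phi> f "- g"] by (simp add: character_uminus)

text \<open>Exponents start at 1 because \<open>norm 1\<close> may exceed 1, so the bound could fail
  for \<open>f ^ 0\<close>.\<close>

lemma norm_power_Suc_le:
  fixes f :: "'a::{comm_ring_1, real_normed_algebra}"
  shows "norm (f ^ Suc n) \<le> norm f ^ Suc n"
proof (induction n)
  case (Suc n)
  have "norm (f ^ Suc (Suc n)) \<le> norm f * norm (f ^ Suc n)"
    by (metis norm_mult_ineq power_Suc)
  also have "\<dots> \<le> norm f * norm f ^ Suc n"
    by (intro mult_left_mono Suc.IH norm_ge_zero)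
  finally show ?case by simp
qed simp

text \<open>A geometric series without its constant term; the equation amounts to
  \<open>(1 - f) * (1 + g) = 1\<close>.\<close>

lemma ex_quasi_inverse:
  fixes f :: "'a::{comm_ring_1, real_normed_algebra, banach}"
  assumes "norm f < 1"
  shows "\<exists>g. g = f + f * g"
proof
  have summable: "summable (\<lambda>n. f ^ Suc n)"
  proof (rule summable_comparison_test)
    show "\<exists>N. \<forall>n\<ge>N. norm (f ^ Suc n) \<le> norm f ^ Suc n"
      using norm_power_Suc_le by blast
    show "summable (\<lambda>n. norm f ^ Suc n)"
      using assms by (subst summable_Suc_iff) (simp add: summable_geometric)
  qed
  \<comment> \<open>Split off the head \<open>f\<close>; every term of the tail contains a further
    factor \<open>f\<close>, which comes out of the sum.\<close>
  show "(\<Sum>n. f ^ Suc n) = f + f * (\<Sum>n. f ^ Suc n)"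
    using suminf_split_head[OF summable] suminf_mult[OF summable, of f]
    by (simp add: algebra_simps)
qed

lemma norm_character_le:
  assumes \<phi>: "\<phi> \<in> character_space"
  shows "norm (\<phi> f) \<le> norm f"
proof (rule ccontr)
  assume "\<not> norm (\<phi> f) \<le> norm f"
  then have less: "norm f < norm (\<phi> f)" by simp
  then have nz: "\<phi> f \<noteq> 0" by auto
  \<comment> \<open>Rescaling gives \<open>h\<close> the value 1 under \<phi>, while
    \<open>less\<close> pushes its norm below 1.\<close>
  define h where "h = inverse (\<phi> f) *\<^sub>C f"
  have "norm h < 1"
    using less nz by (simp add: h_def norm_scaleC norm_inverse norm_divide field_simps)
  then obtain g where "g = h + h * g" using ex_quasi_inverse by blast
  then have "\<phi> g = \<phi> h + \<phi> h * \<phi> g"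
    by (metis character_add character_mult \<phi>)
  moreover have "\<phi> h = 1" using nz by (simp add: h_def character_scaleC \<phi>)
  ultimately show False by simp
qed

text \<open>By additivity, contractivity applies to differences and yields the Lipschitz constant
  1.\<close>

lemma character_continuous:
  assumes \<phi>: "\<phi> \<in> character_space"
  shows "continuous_on S \<phi>"
  by (rule continuous_on_subset[OF lipschitz_on_continuous_on[of 1 UNIV]])
     (auto simp: lipschitz_on_def dist_norm character_diff[OF \<phi>, symmetric] intro: norm_character_le[OF \<phi>])

lemma vanishing_ideal_eq_INT: "vanishing_ideal E = (\<Inter>\<phi>\<in>E. \<phi> -` {0})"
  by (auto simp: vanishing_ideal_def gelfand_transform_def)

lemma closed_vanishing_ideal:
  assumes "E \<subseteq> character_space"
  shows "closed (vanishing_ideal E)"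
  unfolding vanishing_ideal_eq_INT
  using assms by (intro closed_INT ballI closed_vimage closed_singleton) (auto intro: character_continuous)

lemma ideal_vanishing_ideal:
  fixes E :: "('a::banach_function_algebra \<Rightarrow> complex) set"
  assumes "E \<subseteq> character_space"
  shows "ideal (vanishing_ideal E) (ring_of_type_algebra :: 'a ring)"
proof (rule idealI)
  interpret cring "ring_of_type_algebra :: 'a ring" by (rule cring_from_type_algebra)
  show "ring (ring_of_type_algebra :: 'a ring)" ..
  \<comment> \<open>The subgroup axioms speak of the abstract inverse; it must be identified with
    the minus of the type before \<open>character_uminus\<close> applies.\<close>
  have "inv\<^bsub>add_monoid ring_of_type_algebra\<^esub> f = - f" for f :: 'a
    using minus_equality[of "- f" f]
    by (simp add: ring_of_type_algebra_def a_inv_def)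
  then show "subgroup (vanishing_ideal E) (add_monoid (ring_of_type_algebra :: 'a ring))"
    using assms
    by unfold_locales
      (auto simp: vanishing_ideal_eq_INT ring_of_type_algebra_def
        character_add character_zero character_uminus subset_iff)
qed (use assms in \<open>auto simp: vanishing_ideal_eq_INT ring_of_type_algebra_def character_mult subset_iff\<close>)

text \<open>Evaluation at \<open>f\<close> is a coordinate projection, hence continuous for
  pointwise convergence, and the complement of 0 is open.\<close>

lemma openin_nonvanishing_set:
  assumes "E \<subseteq> character_space"
  shows "openin (subtopology gelfand_topology E) {\<phi> \<in> E. \<phi> f \<noteq> 0}"
proof -
  have "continuous_map (product_topology (\<lambda>_. euclidean) UNIV) euclidean (\<lambda>\<phi>. \<phi> f)"
    by (rule continuous_map_product_projection) simp
  then have "openin (product_topology (\<lambda>_. euclidean) UNIV) {\<phi>. \<phi> f \<in> - {0 :: complex}}"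
    using openin_continuous_map_preimage[of _ euclidean "\<lambda>\<phi>. \<phi> f" "- {0}"]
    by (fastforce simp: open_Compl)
  then show ?thesis
    using assms by (auto simp: gelfand_topology_def subtopology_subtopology openin_subtopology)
qed

theorem theorem4p17:
  fixes E :: "('a::banach_function_algebra \<Rightarrow> complex) set"
  assumes "E \<subseteq> character_space" and "E \<noteq> {}" and "t_analytic E"
  shows "closed (vanishing_ideal E) \<and> primeideal (vanishing_ideal E) (ring_of_type_algebra :: 'a ring)"
proof
  show "closed (vanishing_ideal E)"
    using assms(1) by (rule closed_vanishing_ideal)
  show "primeideal (vanishing_ideal E) (ring_of_type_algebra :: 'a ring)"
  proof (rule primeidealI)
    show "ideal (vanishing_ideal E) (ring_of_type_algebra :: 'a ring)"
      using assms(1) by (rule ideal_vanishing_ideal)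
    show "cring (ring_of_type_algebra :: 'a ring)"
      by (rule cring_from_type_algebra)
    \<comment> \<open>Properness: \<open>E\<close> contains some character, and that character is
      nonzero at some element.\<close>
    show "carrier (ring_of_type_algebra :: 'a ring) \<noteq> vanishing_ideal E"
      using assms(1,2) character_nonzero
      by (fastforce simp: ring_of_type_algebra_def vanishing_ideal_eq_INT)
  next
    fix f g :: 'a
    assume "f \<otimes>\<^bsub>ring_of_type_algebra\<^esub> g \<in> vanishing_ideal E"
    then have prod: "\<phi> f * \<phi> g = 0" if "\<phi> \<in> E" for \<phi>
      using assms(1) that
      by (auto simp: ring_of_type_algebra_def vanishing_ideal_eq_INT character_mult subset_iff)
    show "f \<in> vanishing_ideal E \<or> g \<in> vanishing_ideal E"
    proof (cases "{\<phi> \<in> E. \<phi> f \<noteq> 0} = {}")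
      case True
      then show ?thesis by (auto simp: vanishing_ideal_eq_INT)
    next
      case False
      \<comment> \<open>The values are complex numbers, which have no zero divisors.\<close>
      moreover have "\<forall>\<phi>\<in>{\<phi> \<in> E. \<phi> f \<noteq> 0}. \<phi> g = 0" using prod by auto
      ultimately have "\<forall>\<phi>\<in>E. \<phi> g = 0"
        using assms(3) openin_nonvanishing_set[OF assms(1), of f]
        unfolding t_analytic_def gelfand_transform_def by blast
      then show ?thesis by (simp add: vanishing_ideal_eq_INT)
    qed
  qed
qed

end
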